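(* Let $(\mathcal{P}^{\text{co}}_{\mathcal{E}_t})_{t\ge 0}$ be the sequence of DIPK belief sets on $(\Omega,\mathcal{F})$ defined in the context, with lower and upper probabilities $\underline{P}_{\mathcal{E}_t},\overline{P}_{\mathcal{E}_t}$. Let $t\in\mathbb{N}$ and $A\in\mathcal{F}$. If there exist $P_{s,\mathcal{E}_{t-1}},P_{k,\mathcal{E}_{t-1}}\in\mathcal{P}^{\text{co}}_{\mathcal{E}_{t-1}}$ such that $\underline{P}_{\mathcal{E}_t}(A)\ge P_{k,\mathcal{E}_{t-1}}(A)$ and $\overline{P}_{\mathcal{E}_t}(A)\le P_{s,\mathcal{E}_{t-1}}(A)$, and at least one of these inequalities is strict, then $\mathcal{P}^{\text{co}}_{\mathcal{E}_t}$ DIPK-contracts with respect to $\mathcal{P}^{\text{co}}_{\mathcal{E}_{t-1}}$ for $A$.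
   Context: $\Omega$ is at most countable, $\mathcal{F}=2^\Omega$, $\Delta(\Omega,\mathcal{F})$ is the set of probability measures on $(\Omega,\mathcal{F})$, $X:\Omega\to\mathcal{X}$ is a function, $(x_i)_{i\ge1}$ is a sequence of data points in $X(\Omega)$, $0=n_0<n_1<n_2<\cdots$ are integers, $\beta$ takes values in $[0,1]$, $\mathbb{N}=\{1,2,\dots\}$. DPK update of a measure. At time $t\ge 1$ the data $x_1,\dots,x_{n_t}$ are available. Let $E_1,\dots,E_m$ be the distinct sets among $X^{-1}(x_1),\dots,X^{-1}(x_{n_t})$, $E_{m+1}=\Omega\setminus\bigcup_{j=1}^m E_j$, and $\mathcal{E}_t=\{E_1,\dots,E_{m+1}\}$. If $E_{m+1}\ne\emptyset$, $P^{emp}_t(E_j)=\frac{1}{n_t+1}\#\{i\le n_t: X^{-1}(x_i)=E_j\}$ for $j\le m$ and $P^{emp}_t(E_{m+1})=1-\sum_{j=1}^m P^{emp}_t(E_j)$; if $E_{m+1}=\emptyset$, $P^{emp}_t(E_j)=\frac{1}{n_t}\#\{i\le n_t: X^{-1}(x_i)=E_j\}$ for $j\le m$ and $P^{emp}_t(E_{m+1})=0$. The time-$t$ DPK update of $P_{\mathcal{E}_{t-1}}\in\Delta(\Omega,\mathcal{F})$ is $P_{\mathcal{E}_t}(A)=\sum_{E_j\in\mathcal{E}_t}P_{\mathcal{E}_{t-1}}(A\mid E_j)P_{\mathcal{E}_t}(E_j)$, $A\in\mathcal{F}$, with $P_{\mathcal{E}_t}(E_j)=\beta(n_t)P_{\mathcal{E}_{t-1}}(E_j)+[1-\beta(n_t)]P^{emp}_t(E_j)$.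 Terms with $E_j=\emptyset$ are $0$ in all sums. DIPK. The agent specifies a set $\mathcal{P}\subset\Delta(\Omega,\mathcal{F})$ with lower probability $\underline{P}(A)=\inf_{P\in\mathcal{P}}P(A)$. The initial belief set is $\mathcal{P}^{\text{co}}_{\mathcal{E}_0}=\text{core}(\underline{P})=\{P\in\Delta(\Omega,\mathcal{F}):P(A)\ge\underline{P}(A)\ \forall A\in\mathcal{F}\}$, and $\mathcal{P}_{\mathcal{E}_0}$ is its set of extreme points, assumed finite, with $\mathcal{P}^{\text{co}}_{\mathcal{E}_0}=\text{Conv}(\mathcal{P}_{\mathcal{E}_0})$ and with every $P\in\mathcal{P}_{\mathcal{E}_0}$ positive on all nonempty events. For $t\ge1$, $\mathcal{P}_{\mathcal{E}_t}$ is the set of time-$t$ DPK updates of the elements of $\mathcal{P}_{\mathcal{E}_{t-1}}$, and $\mathcal{P}^{\text{co}}_{\mathcal{E}_t}=\text{Conv}(\mathcal{P}_{\mathcal{E}_t})$ (convex hull). Put $\underline{P}_{\mathcal{E}_t}(A)=\inf_{P\in\mathcal{P}^{\text{co}}_{\mathcal{E}_t}}P(A)$ and $\overline{P}_{\mathcal{E}_t}(A)=\sup_{P\in\mathcal{P}^{\text{co}}_{\mathcal{E}_t}}P(A)=1-\underline{P}_{\mathcal{E}_t}(A^c)$. $\mathcal{P}^{\text{co}}_{\mathcal{E}_t}$ DIPK-contracts with respect to $\mathcal{P}^{\text{co}}_{\mathcal{E}_{t-1}}$ for $A$ if $\underline{P}_{\mathcal{E}_t}(A)\ge\underline{P}_{\mathcal{E}_{t-1}}(A)$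 and $\overline{P}_{\mathcal{E}_t}(A)\le\overline{P}_{\mathcal{E}_{t-1}}(A)$, with at least one inequality strict. *)

theory Defs
  imports "HOL-Probability.Probability" "HOL-Library.Function_Algebras"
begin

text \<open>
  Functions into a real vector space form a real vector space pointwise. Probability measures are
  handled below as set functions \<open>'a set \<Rightarrow> real\<close>, so that the library's \<open>convex hull\<close> and
  \<open>extreme_point_of\<close> apply to sets of them.
\<close>

instantiation "fun" :: (type, real_vector) real_vector
begin

definition scaleR_fun :: "real \<Rightarrow> ('a \<Rightarrow> 'b) \<Rightarrow> 'a \<Rightarrow> 'b" where
  "scaleR_fun r f = (\<lambda>x. r *\<^sub>R f x)"

instance
  by standard (auto simp: scaleR_fun_def plus_fun_def scaleR_add_right scaleR_add_left)

end

text \<open>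
  The set functions of the probability measures on \<open>(\<Omega>, Pow \<Omega>)\<close>. By convention of \<open>measure\<close> they
  vanish on sets that are not subsets of \<open>\<Omega>\<close>, so equality and linear combinations of elements are
  determined by the values on \<open>Pow \<Omega>\<close>.
\<close>

definition prob_measures :: "'a set \<Rightarrow> ('a set \<Rightarrow> real) set" where
  "prob_measures \<Omega> = {measure M | M. prob_space M \<and> space M = \<Omega> \<and> sets M = Pow \<Omega>}"

definition lower_prob :: "('a set \<Rightarrow> real) set \<Rightarrow> 'a set \<Rightarrow> real" where
  "lower_prob K A = (INF P\<in>K. P A)"

definition upper_prob :: "('a set \<Rightarrow> real) set \<Rightarrow> 'a set \<Rightarrow> real" where
  "upper_prob K A = (SUP P\<in>K. P A)"

definition core :: "'a set \<Rightarrow> ('a set \<Rightarrow> real) \<Rightarrow> ('a set \<Rightarrow> real) set" where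
  "core \<Omega> L = {P \<in> prob_measures \<Omega>. \<forall>A\<subseteq>\<Omega>. P A \<ge> L A}"

text \<open>
  The argument \<open>N\<close> of the following functions is the number of available data points; the data
  are \<open>x 1, \<dots>, x N\<close>.
\<close>

definition fiber :: "'a set \<Rightarrow> ('a \<Rightarrow> 'x) \<Rightarrow> 'x \<Rightarrow> 'a set" where
  "fiber \<Omega> X y = {\<omega> \<in> \<Omega>. X \<omega> = y}"

definition observed_cells :: "'a set \<Rightarrow> ('a \<Rightarrow> 'x) \<Rightarrow> (nat \<Rightarrow> 'x) \<Rightarrow> nat \<Rightarrow> 'a set set" where
  "observed_cells \<Omega> X x N = (\<lambda>i. fiber \<Omega> X (x i)) ` {1..N}"

definition residual_cell :: "'a set \<Rightarrow> ('a \<Rightarrow> 'x) \<Rightarrow> (nat \<Rightarrow> 'x) \<Rightarrow> nat \<Rightarrow> 'a set" where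
  "residual_cell \<Omega> X x N = \<Omega> - \<Union>(observed_cells \<Omega> X x N)"

definition data_partition :: "'a set \<Rightarrow> ('a \<Rightarrow> 'x) \<Rightarrow> (nat \<Rightarrow> 'x) \<Rightarrow> nat \<Rightarrow> 'a set set" where
  "data_partition \<Omega> X x N = insert (residual_cell \<Omega> X x N) (observed_cells \<Omega> X x N)"

definition cell_count :: "'a set \<Rightarrow> ('a \<Rightarrow> 'x) \<Rightarrow> (nat \<Rightarrow> 'x) \<Rightarrow> nat \<Rightarrow> 'a set \<Rightarrow> nat" where
  "cell_count \<Omega> X x N E = card {i \<in> {1..N}. fiber \<Omega> X (x i) = E}"

text \<open>
  Only the values on \<open>data_partition \<Omega> X x N\<close> are meaningful. When the data points lie in \<open>X ` \<Omega>\<close>,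
  the observed cells are nonempty, so the residual cell is never one of them.
\<close>

definition emp_prob :: "'a set \<Rightarrow> ('a \<Rightarrow> 'x) \<Rightarrow> (nat \<Rightarrow> 'x) \<Rightarrow> nat \<Rightarrow> 'a set \<Rightarrow> real" where
  "emp_prob \<Omega> X x N E =
    (if residual_cell \<Omega> X x N \<noteq> {} then
       if E \<in> observed_cells \<Omega> X x N then real (cell_count \<Omega> X x N E) / (real N + 1)
       else 1 - (\<Sum>F\<in>observed_cells \<Omega> X x N. real (cell_count \<Omega> X x N F) / (real N + 1))
     else
       if E \<in> observed_cells \<Omega> X x N then real (cell_count \<Omega> X x N E) / real N
       else 0)"

definition cond_measure :: "('a set \<Rightarrow> real) \<Rightarrow> 'a set \<Rightarrow> 'a set \<Rightarrow> real" where
  "cond_measure P A E = P (A \<inter> E) / P E"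

definition dpk_weight ::
    "'a set \<Rightarrow> ('a \<Rightarrow> 'x) \<Rightarrow> (nat \<Rightarrow> 'x) \<Rightarrow> (nat \<Rightarrow> real) \<Rightarrow> nat \<Rightarrow> ('a set \<Rightarrow> real) \<Rightarrow> 'a set \<Rightarrow> real"
  where
  "dpk_weight \<Omega> X x \<beta> N P E = \<beta> N * P E + (1 - \<beta> N) * emp_prob \<Omega> X x N E"

text \<open>
  The value outside \<open>Pow \<Omega>\<close> follows the convention of \<open>prob_measures\<close>.
\<close>

definition dpk_update ::
    "'a set \<Rightarrow> ('a \<Rightarrow> 'x) \<Rightarrow> (nat \<Rightarrow> 'x) \<Rightarrow> (nat \<Rightarrow> real) \<Rightarrow> nat \<Rightarrow> ('a set \<Rightarrow> real) \<Rightarrow> 'a set \<Rightarrow> real"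
  where
  "dpk_update \<Omega> X x \<beta> N P A =
    (if A \<subseteq> \<Omega>
     then \<Sum>E\<in>data_partition \<Omega> X x N - {{}}. cond_measure P A E * dpk_weight \<Omega> X x \<beta> N P E
     else 0)"

primrec dipk_gen ::
    "'a set \<Rightarrow> ('a \<Rightarrow> 'x) \<Rightarrow> (nat \<Rightarrow> 'x) \<Rightarrow> (nat \<Rightarrow> nat) \<Rightarrow> (nat \<Rightarrow> real) \<Rightarrow> ('a set \<Rightarrow> real) set
      \<Rightarrow> nat \<Rightarrow> ('a set \<Rightarrow> real) set"
  where
  "dipk_gen \<Omega> X x n \<beta> \<P> 0 = {P. P extreme_point_of core \<Omega> (lower_prob \<P>)}"
| "dipk_gen \<Omega> X x n \<beta> \<P> (Suc t) = dpk_update \<Omega> X x \<beta> (n (Suc t)) ` dipk_gen \<Omega> X x n \<beta> \<P> t"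

definition dipk_belief ::
    "'a set \<Rightarrow> ('a \<Rightarrow> 'x) \<Rightarrow> (nat \<Rightarrow> 'x) \<Rightarrow> (nat \<Rightarrow> nat) \<Rightarrow> (nat \<Rightarrow> real) \<Rightarrow> ('a set \<Rightarrow> real) set
      \<Rightarrow> nat \<Rightarrow> ('a set \<Rightarrow> real) set"
  where
  "dipk_belief \<Omega> X x n \<beta> \<P> t =
    (if t = 0 then core \<Omega> (lower_prob \<P>) else convex hull (dipk_gen \<Omega> X x n \<beta> \<P> t))"

definition dipk_contracts ::
    "('a set \<Rightarrow> real) set \<Rightarrow> ('a set \<Rightarrow> real) set \<Rightarrow> 'a set \<Rightarrow> bool" where
  "dipk_contracts K' K A \<longleftrightarrow>
    lower_prob K' A \<ge> lower_prob K A \<and> upper_prob K' A \<le> upper_prob K A \<and>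
    (lower_prob K' A > lower_prob K A \<or> upper_prob K' A < upper_prob K A)"

end

theory Submission
  imports Defs
begin

text \<open>
  A point of the earlier belief set bounds its lower probability from above and its upper
  probability from below, so the two comparisons with \<open>Pk\<close> and \<open>Ps\<close> chain to the comparisons of
  the two belief sets, and a strict one stays strict. This step needs the infimum and the supremum
  to be genuine bounds. They are, because each belief set is the convex hull of a finite set of
  generators (\<open>dipk_belief_convex_hull\<close>, \<open>finite_dipk_gen\<close>), and the linear map \<open>P \<mapsto> P A\<close> sends
  such a hull to a bounded set of reals (\<open>bounded_evaluation_convex_hull\<close>).
\<close>

lemma linear_evaluation: "linear (\<lambda>P :: 'b \<Rightarrow> real. P a)"
  by (rule linearI) (simp_all add: scaleR_fun_def)

text \<open>
  Linearity turns the image of the hull into the convex hull of the finitely many values at \<open>a\<close>,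
  and the convex hull of a finite set of reals is bounded.
\<close>

lemma bounded_evaluation_convex_hull:
  fixes S :: "('b \<Rightarrow> real) set"
  assumes "finite S"
  shows "bounded ((\<lambda>P. P a) ` (convex hull S))"
  using assms
  by (simp add: convex_hull_linear_image [OF linear_evaluation] finite_imp_bounded_convex_hull)

lemma finite_dipk_gen:
  assumes "finite (dipk_gen \<Omega> X x n \<beta> \<P> 0)"
  shows "finite (dipk_gen \<Omega> X x n \<beta> \<P> t)"
proof (induction t)
  case 0
  show ?case by (rule assms)
next
  case (Suc t)
  then show ?case by simp
qed

lemma dipk_belief_convex_hull:
  assumes "dipk_belief \<Omega> X x n \<beta> \<P> 0 = convex hull (dipk_gen \<Omega> X x n \<beta> \<P> 0)"
  shows "dipk_belief \<Omega> X x n \<beta> \<P> t = convex hull (dipk_gen \<Omega> X x n \<beta> \<P> t)"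
proof (cases "t = 0")
  case True
  with assms show ?thesis by simp
next
  case False
  then show ?thesis by (simp add: dipk_belief_def)
qed

lemma dipk_contractsI:
  assumes bounded: "bounded ((\<lambda>P. P A) ` K)"
    and "Ps \<in> K" and "Pk \<in> K"
    and "Pk A \<le> lower_prob K' A" and "upper_prob K' A \<le> Ps A"
    and "Pk A < lower_prob K' A \<or> upper_prob K' A < Ps A"
  shows "dipk_contracts K' K A"
proof -
  have "lower_prob K A \<le> Pk A"
    unfolding lower_prob_def
    by (rule cINF_lower [OF bounded_imp_bdd_below [OF bounded] \<open>Pk \<in> K\<close>])
  moreover have "Ps A \<le> upper_prob K A"
    unfolding upper_prob_def
    by (rule cSUP_upper [OF \<open>Ps \<in> K\<close> bounded_imp_bdd_above [OF bounded]])
  ultimately show ?thesis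
    using assms(4-6) unfolding dipk_contracts_def by linarith
qed

theorem proposition24:
  fixes \<Omega> :: "'a set" and X :: "'a \<Rightarrow> 'x" and x :: "nat \<Rightarrow> 'x" and n :: "nat \<Rightarrow> nat"
    and \<beta> :: "nat \<Rightarrow> real" and \<P> :: "('a set \<Rightarrow> real) set" and t :: nat and A :: "'a set"
  assumes "countable \<Omega>"
    and "\<And>i. i \<ge> 1 \<Longrightarrow> x i \<in> X ` \<Omega>"
    and "n 0 = 0" and "strict_mono n"
    and "\<And>k. \<beta> k \<in> {0..1}"
    and "\<P> \<subseteq> prob_measures \<Omega>" and "\<P> \<noteq> {}"
    and "finite (dipk_gen \<Omega> X x n \<beta> \<P> 0)"
    and "dipk_belief \<Omega> X x n \<beta> \<P> 0 = convex hull (dipk_gen \<Omega> X x n \<beta> \<P> 0)"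
    and "\<And>P B. P \<in> dipk_gen \<Omega> X x n \<beta> \<P> 0 \<Longrightarrow> B \<subseteq> \<Omega> \<Longrightarrow> B \<noteq> {} \<Longrightarrow> P B > 0"
    and "t \<ge> 1" and "A \<subseteq> \<Omega>"
    and "\<exists>Ps \<in> dipk_belief \<Omega> X x n \<beta> \<P> (t - 1). \<exists>Pk \<in> dipk_belief \<Omega> X x n \<beta> \<P> (t - 1).
           lower_prob (dipk_belief \<Omega> X x n \<beta> \<P> t) A \<ge> Pk A \<and>
           upper_prob (dipk_belief \<Omega> X x n \<beta> \<P> t) A \<le> Ps A \<and>
           (lower_prob (dipk_belief \<Omega> X x n \<beta> \<P> t) A > Pk A \<or>
            upper_prob (dipk_belief \<Omega> X x n \<beta> \<P> t) A < Ps A)"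
  shows "dipk_contracts (dipk_belief \<Omega> X x n \<beta> \<P> t) (dipk_belief \<Omega> X x n \<beta> \<P> (t - 1)) A"
proof -
  have "bounded ((\<lambda>P. P A) ` dipk_belief \<Omega> X x n \<beta> \<P> (t - 1))"
    unfolding dipk_belief_convex_hull [OF assms(9)]
    by (rule bounded_evaluation_convex_hull [OF finite_dipk_gen [OF assms(8)]])
  then show ?thesis
    using assms(13) by (blast intro: dipk_contractsI)
qed

end
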